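(* Let $k\ge 1$ and let $X$ be a discrete and proper metric space with a base point $x_0\in X$. If $X$ is integrally $(k,k)$-quasi-geodesic, then its quasi-geodesic boundary $\partial_{QG}X$ is compact metrizable, and every point of $\partial_{QG}X$ is the limit (in $X_{QG}$) of some integral $(k,k)$-quasi-geodesic ray starting at the base point $x_0$.
   Context: $Z_+$ is the set of positive integers. For $q\ge 1$, $Q\ge 0$, an integral $(q,Q)$-quasi-geodesic in a metric space $(X,d)$ is a function $g:(a,b)\cap Z_+\to X$ (the interval may be unbounded) with $\frac{|x-y|}{q}-Q\le d(g(x),g(y))\le q|x-y|+Q$ for all $x,y$ in its domain. It originates (starts) at $x_0$ if $1$ is in its domain and $g(1)=x_0$; it is a ray if its domain is $Z_+$. $X$ is integrally $(q,Q)$-quasi-geodesic if every two points of $X$ can be joined by an integral $(q,Q)$-quasi-geodesic. For $k\ge 1$, $m\ge 1$ and an integral $(k,k)$-quasi-geodesic ray $g$ with $g(1)=x_0$, the $m$-cone $C_X(x_0,k,k,g,m)$ is the set of all $x\in X$ such that $x=h(i)$ for some $i\ge m$ and some integral $(k,k)$-quasi-geodesic $h$ (possibly with finite domain) with $h(1)=x_0$ and $h(j)=g(j)$ for all $j\le m$. A function $f:X\to\mathbb{C}$ is slowly-oscillating if $|f(x_n)-f(y_n)|\to 0$ whenever $x_n\to\infty$ (i.e. $d(x_0,x_n)\to\infty$) and $d(x_n,y_n)<M$ for all $n$, for some $M>0$. A bounded continuous slowly-oscillating function $f:X\to\mathbb{C}$ is geometrically slowly-oscillating if for every $\epsilon>0$,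 every $k\ge1$, every $x_0\in X$ and every integral $(k,k)$-quasi-geodesic ray $g$ in $X$ originating at $x_0$ there is $m\ge 1$ such that the diameter of $f(C_X(x_0,k,k,g,m))$ is smaller than $\epsilon$. $C_{QG}(X)$ is the $C^*$-algebra of all geometrically slowly-oscillating functions on $X$. The quasi-geodesic compactification $X_{QG}$ is the maximal ideal space of $C_{QG}(X)$ (equivalently, the compactification of $X$ such that the functions in $C_{QG}(X)$ are exactly the restrictions to $X$ of continuous functions $X_{QG}\to\mathbb{C}$). For proper $X$, the quasi-geodesic boundary is $\partial_{QG}X:=X_{QG}\setminus X$. *)

theory Defs
  imports "HOL-Analysis.Analysis"
begin

text \<open>The metric space \<open>X\<close> is the whole type \<open>'a::metric_space\<close>. Partial functions
  defined on \<open>(a,b) \<inter> Z\<^sub>+\<close> are rendered as a total function on \<open>nat\<close> together with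
  their domain; values outside the domain are irrelevant.\<close>

definition integral_interval :: "nat set \<Rightarrow> bool" where
  "integral_interval D \<longleftrightarrow>
     (\<exists>a b :: ereal. D = {n. 1 \<le> n \<and> a < ereal (real n) \<and> ereal (real n) < b})"

definition integral_quasi_geodesic ::
    "real \<Rightarrow> real \<Rightarrow> nat set \<Rightarrow> (nat \<Rightarrow> 'a::metric_space) \<Rightarrow> bool" where
  "integral_quasi_geodesic q Q D g \<longleftrightarrow>
     integral_interval D \<and>
     (\<forall>x\<in>D. \<forall>y\<in>D.
        \<bar>real x - real y\<bar> / q - Q \<le> dist (g x) (g y) \<and>
        dist (g x) (g y) \<le> q * \<bar>real x - real y\<bar> + Q)"

definition originates_at :: "nat set \<Rightarrow> (nat \<Rightarrow> 'a) \<Rightarrow> 'a \<Rightarrow> bool" where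
  "originates_at D g p \<longleftrightarrow> 1 \<in> D \<and> g 1 = p"

definition integral_quasi_geodesic_ray ::
    "real \<Rightarrow> real \<Rightarrow> (nat \<Rightarrow> 'a::metric_space) \<Rightarrow> bool" where
  "integral_quasi_geodesic_ray q Q g \<longleftrightarrow> integral_quasi_geodesic q Q {1..} g"

definition integrally_quasi_geodesic_space ::
    "'a::metric_space itself \<Rightarrow> real \<Rightarrow> real \<Rightarrow> bool" where
  "integrally_quasi_geodesic_space _ q Q \<longleftrightarrow>
     (\<forall>x y :: 'a. \<exists>D g. integral_quasi_geodesic q Q D g \<and> finite D \<and> D \<noteq> {} \<and>
        g (Min D) = x \<and> g (Max D) = y)"

definition proper_space :: "'a::metric_space itself \<Rightarrow> bool" where
  "proper_space _ \<longleftrightarrow> (\<forall>(p::'a) r. compact (cball p r))"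

definition cone ::
    "'a::metric_space \<Rightarrow> real \<Rightarrow> real \<Rightarrow> (nat \<Rightarrow> 'a) \<Rightarrow> nat \<Rightarrow> 'a set" where
  "cone p q Q g m =
     {x. \<exists>D h i. integral_quasi_geodesic q Q D h \<and> originates_at D h p \<and>
           (\<forall>j\<in>{1..m}. j \<in> D \<and> h j = g j) \<and> i \<in> D \<and> m \<le> i \<and> x = h i}"

definition tends_to_infinity :: "(nat \<Rightarrow> 'a::metric_space) \<Rightarrow> bool" where
  "tends_to_infinity xs \<longleftrightarrow> (\<forall>p. filterlim (\<lambda>n. dist p (xs n)) at_top sequentially)"

definition slowly_oscillating :: "('a::metric_space \<Rightarrow> complex) \<Rightarrow> bool" where
  "slowly_oscillating f \<longleftrightarrow>
     (\<forall>xs ys M. tends_to_infinity xs \<and> M > 0 \<and> (\<forall>n. dist (xs n) (ys n) < M)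
        \<longrightarrow> (\<lambda>n. cmod (f (xs n) - f (ys n))) \<longlonglongrightarrow> 0)"

definition geometrically_slowly_oscillating :: "('a::metric_space \<Rightarrow> complex) \<Rightarrow> bool" where
  "geometrically_slowly_oscillating f \<longleftrightarrow>
     bounded (range f) \<and> continuous_on UNIV f \<and> slowly_oscillating f \<and>
     (\<forall>\<epsilon>>0. \<forall>k\<ge>1. \<forall>p g. integral_quasi_geodesic_ray k k g \<and> originates_at {1..} g p
        \<longrightarrow> (\<exists>m\<ge>1. diameter (f ` cone p k k g m) < \<epsilon>))"

definition C_QG :: "('a::metric_space \<Rightarrow> complex) set" where
  "C_QG = {f. geometrically_slowly_oscillating f}"

text \<open>The maximal ideal space of an algebra \<open>A\<close> of complex functions with pointwise
  operations is the set of its characters (nonzero algebra homomorphisms to \<open>complex\<close>,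
  whose kernels are the maximal ideals) with the Gelfand topology, i.e. pointwise
  convergence on \<open>A\<close>. Extensionality makes a character determined by its values on \<open>A\<close>.
  Continuity and preservation of conjugation are automatic for a commutative
  \<open>C\<close>*-algebra.\<close>

definition characters :: "('a \<Rightarrow> complex) set \<Rightarrow> (('a \<Rightarrow> complex) \<Rightarrow> complex) set" where
  "characters A = {\<phi> \<in> extensional A.
     (\<forall>f\<in>A. \<forall>g\<in>A. \<phi> (\<lambda>x. f x + g x) = \<phi> f + \<phi> g) \<and>
     (\<forall>c. \<forall>f\<in>A. \<phi> (\<lambda>x. c * f x) = c * \<phi> f) \<and>
     (\<forall>f\<in>A. \<forall>g\<in>A. \<phi> (\<lambda>x. f x * g x) = \<phi> f * \<phi> g) \<and>
     (\<exists>f\<in>A. \<phi> f \<noteq> 0)}"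

definition maximal_ideal_space ::
    "('a \<Rightarrow> complex) set \<Rightarrow> (('a \<Rightarrow> complex) \<Rightarrow> complex) topology" where
  "maximal_ideal_space A =
     subtopology (product_topology (\<lambda>_. euclidean) A) (characters A)"

definition X_QG :: "(('a::metric_space \<Rightarrow> complex) \<Rightarrow> complex) topology" where
  "X_QG = maximal_ideal_space C_QG"

text \<open>The canonical map of \<open>X\<close> into \<open>X_QG\<close>: a point goes to evaluation at it.\<close>

definition point_QG :: "'a::metric_space \<Rightarrow> (('a \<Rightarrow> complex) \<Rightarrow> complex)" where
  "point_QG x = restrict (\<lambda>f. f x) C_QG"

definition boundary_QG :: "(('a::metric_space \<Rightarrow> complex) \<Rightarrow> complex) set" where
  "boundary_QG = topspace X_QG - range point_QG"

end

theory Submission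
  imports Defs
begin

text \<open>
  Points of \<open>X_QG\<close> are approximated by points of \<open>X\<close>, and points of \<open>X\<close> are the ends of finite
  quasi-geodesics from \<open>x0\<close>; the boundary is read off from the tree of initial segments of
  these quasi-geodesics. The tree is finitely branching, because balls are compact and discrete,
  hence finite.

  A character \<open>\<xi>\<close> of \<open>C_QG\<close> lies in the closure of \<open>X\<close> (\<open>X_QG_closure_of_points\<close>). This
  is the usual argument: were \<open>X\<close> to avoid a neighbourhood of \<open>\<xi>\<close>, then a sum of
  squares \<open>\<Sum> \<bar>f - \<xi> f\<bar>\<^sup>2\<close> in the kernel of \<open>\<xi>\<close> would be bounded away from \<open>0\<close>, hence
  invertible. It needs \<open>C_QG\<close> to be closed under sums, products, conjugation and such inverses,
  and all of these follow from one observation (\<open>C_QG_dominated\<close>): a bounded function whose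
  increments are dominated by those of finitely many members of \<open>C_QG\<close> is in \<open>C_QG\<close>. As a
  by-product \<open>\<bar>\<xi> f\<bar> \<le> sup \<bar>f\<bar>\<close>, so Tychonoff's theorem makes \<open>X_QG\<close> compact; the boundary is
  closed in it, since it consists of the characters that vanish on the indicators of all points.

  The cone over an initial segment of length \<open>m\<close> is, up to one point, the union of finitely many
  cones over segments of length \<open>Suc m\<close> (\<open>cone_subset_successors\<close>). A boundary point is not in
  the closure of a finite subset of \<open>X\<close>, so if it is in the closure of a cone then it is in the
  closure of one of the successors. Koenig's argument yields a ray \<open>g\<close> such that \<open>\<xi>\<close> is in the
  closure of every cone along \<open>g\<close>. The diameters of the images of these cones under any \<open>f\<close>
  in \<open>C_QG\<close> tend to \<open>0\<close>, and \<open>g n\<close> lies in the \<open>n\<close>-th cone, so \<open>f (g n)\<close> tends to \<open>\<xi> f\<close>: the ray converges to \<open>\<xi>\<close>.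

  For metrizability, let \<open>\<xi> \<noteq> \<eta>\<close> be boundary points with such rays \<open>g\<close> and \<open>h\<close>. A function in
  \<open>C_QG\<close> that tells \<open>\<xi>\<close> from \<open>\<eta>\<close> is nearly constant on the far cones along both rays, so the
  closures of these cones are disjoint. There are only countably many cones, and a compact
  Hausdorff space whose points are separated by disjoint members of a countable family of closed
  sets is metrizable (\<open>metrizable_space_if_countable_closed_separation\<close>).
\<close>

section \<open>A metrizability criterion\<close>

text \<open>
  Urysohn functions for the countably many disjoint pairs of members of \<open>\<K>\<close> separate points, so
  together they embed the compact space \<open>Y\<close> into a countable power of the real line.
\<close>

lemma metrizable_space_if_countable_closed_separation:
  assumes "compact_space Y" and "Hausdorff_space Y" and "countable \<K>"
    and closed: "\<And>K. K \<in> \<K> \<Longrightarrow> closedin Y K"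
    and sep: "\<And>x y. \<lbrakk>x \<in> topspace Y; y \<in> topspace Y; x \<noteq> y\<rbrakk>
               \<Longrightarrow> \<exists>K\<in>\<K>. \<exists>L\<in>\<K>. x \<in> K \<and> y \<in> L \<and> disjnt K L"
  shows "metrizable_space Y"
proof -
  define P where "P = {(K, L). K \<in> \<K> \<and> L \<in> \<K> \<and> disjnt K L}"
  have "countable P"
    by (rule countable_subset[of _ "\<K> \<times> \<K>"]) (auto simp: P_def \<open>countable \<K>\<close>)
  have "normal_space Y"
    using assms(1,2) compact_Hausdorff_or_regular_imp_normal_space by blast
  have "\<forall>p\<in>P. \<exists>f. continuous_map Y euclideanreal f \<and> f ` fst p \<subseteq> {0} \<and> f ` snd p \<subseteq> {1}"
    by (metis (mono_tags, lifting) P_def Urysohn_lemma_alt \<open>normal_space Y\<close> case_prod_beta closed mem_Collect_eq)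
  then obtain u where u: "\<And>p. p \<in> P \<Longrightarrow> continuous_map Y euclideanreal (u p)"
      "\<And>p. p \<in> P \<Longrightarrow> u p ` fst p \<subseteq> {0}" "\<And>p. p \<in> P \<Longrightarrow> u p ` snd p \<subseteq> {1::real}"
    by metis
  define e where "e = (\<lambda>y. restrict (\<lambda>p. u p y) P)"
  let ?Z = "product_topology (\<lambda>_. euclideanreal) P"
  have "continuous_map Y ?Z e"
    by (auto simp: continuous_map_componentwise e_def u)
  moreover have "inj_on e (topspace Y)"
  proof (rule inj_onI, rule ccontr)
    fix x y assume "x \<in> topspace Y" "y \<in> topspace Y" "e x = e y" "x \<noteq> y"
    then obtain K L where KL: "K \<in> \<K>" "L \<in> \<K>" "x \<in> K" "y \<in> L" "disjnt K L"
      using sep by blast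
    then have "(K, L) \<in> P"
      by (simp add: P_def)
    then have "u (K, L) x = 0" "u (K, L) y = 1"
      using u(2,3)[of "(K, L)"] KL by auto
    moreover have "u (K, L) x = u (K, L) y"
      using fun_cong[OF \<open>e x = e y\<close>, of "(K, L)"] \<open>(K, L) \<in> P\<close> by (simp add: e_def)
    ultimately show False
      by simp
  qed
  moreover have "Hausdorff_space ?Z"
    by (simp add: Hausdorff_space_product_topology)
  ultimately have "Y homeomorphic_space subtopology ?Z (e ` topspace Y)"
    using \<open>compact_space Y\<close>
    by (intro embedding_map_imp_homeomorphic_space continuous_imp_embedding_map)
  moreover have "metrizable_space ?Z"
    using \<open>countable P\<close> countable_subset[OF _ \<open>countable P\<close>]
    by (auto simp: metrizable_space_product_topology metrizable_space_euclidean)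
  ultimately show ?thesis
    using homeomorphic_metrizable_space metrizable_space_subtopology by blast
qed

section \<open>Quasi-geodesics and cones\<close>

lemma integral_interval_between:
  assumes "integral_interval D" "i \<in> D" "j \<in> D" "i \<le> l" "l \<le> j"
  shows "l \<in> D"
proof -
  obtain a b where D: "D = {n. 1 \<le> n \<and> a < ereal (real n) \<and> ereal (real n) < b}"
    using assms(1) by (auto simp: integral_interval_def)
  have "ereal (real i) \<le> ereal (real l)" "ereal (real l) \<le> ereal (real j)"
    using assms by auto
  then show ?thesis
    using assms(2-4) unfolding D
    by (auto intro: less_le_trans[of a "ereal (real i)"] le_less_trans[of _ "ereal (real j)" b])
qed

lemma integral_interval_ge_1: "integral_interval D \<Longrightarrow> i \<in> D \<Longrightarrow> 1 \<le> i"
  by (auto simp: integral_interval_def)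

lemma integral_interval_atLeastAtMost_1: "integral_interval {1..n}"
  unfolding integral_interval_def
  by (rule exI[of _ "-\<infinity>"], rule exI[of _ "ereal (real n + 1)"]) auto

lemma integral_interval_atLeast_1: "integral_interval {1..}"
  unfolding integral_interval_def
  by (rule exI[of _ "-\<infinity>"], rule exI[of _ "\<infinity>"]) auto

lemma integral_quasi_geodesic_bounds:
  assumes "integral_quasi_geodesic q Q D g" "i \<in> D" "j \<in> D"
  shows "\<bar>real i - real j\<bar> / q - Q \<le> dist (g i) (g j)"
    and "dist (g i) (g j) \<le> q * \<bar>real i - real j\<bar> + Q"
  using assms by (auto simp: integral_quasi_geodesic_def)

lemma mem_coneI:
  assumes "integral_quasi_geodesic q Q D h" "1 \<in> D" "h 1 = p"
    and "\<And>j. 1 \<le> j \<Longrightarrow> j \<le> m \<Longrightarrow> h j = g j" and "i \<in> D" "m \<le> i"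
  shows "h i \<in> cone p q Q g m"
proof -
  have "j \<in> D" if "1 \<le> j" "j \<le> m" for j
    using integral_interval_between[of D 1 i j] assms that
    by (auto simp: integral_quasi_geodesic_def)
  then have "\<forall>j\<in>{1..m}. j \<in> D \<and> h j = g j"
    using assms(4) by simp
  then show ?thesis
    unfolding cone_def originates_at_def mem_Collect_eq using assms(1-3,5,6) by blast
qed

lemma mem_coneE:
  assumes "x \<in> cone p q Q g m"
  obtains D h i where "integral_quasi_geodesic q Q D h" "1 \<in> D" "h 1 = p"
    "\<And>j. 1 \<le> j \<Longrightarrow> j \<le> m \<Longrightarrow> j \<in> D \<and> h j = g j" "i \<in> D" "m \<le> i" "x = h i"
proof -
  from assms obtain D h i where "integral_quasi_geodesic q Q D h" "1 \<in> D" "h 1 = p"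
    "\<forall>j\<in>{1..m}. j \<in> D \<and> h j = g j" "i \<in> D" "m \<le> i" "x = h i"
    unfolding cone_def originates_at_def by blast
  then show ?thesis
    using that[of D h i] by simp
qed

lemma cone_antimono: "m \<le> n \<Longrightarrow> cone p q Q g n \<subseteq> cone p q Q g m"
  by (rule subsetI, erule mem_coneE) (auto intro: mem_coneI)

lemma cone_cong:
  assumes "\<And>j. 1 \<le> j \<Longrightarrow> j \<le> m \<Longrightarrow> g j = g' j"
  shows "cone p q Q g m = cone p q Q g' m"
  using assms by (simp add: cone_def)

lemma ray_mem_cone:
  assumes "integral_quasi_geodesic_ray q Q g" "originates_at {1..} g p" "1 \<le> m" "m \<le> i"
  shows "g i \<in> cone p q Q g m"
  by (rule mem_coneI[where D = "{1..}"])
    (use assms in \<open>auto simp: integral_quasi_geodesic_ray_def originates_at_def\<close>)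

text \<open>
  Every point is joined to \<open>p\<close> by a quasi-geodesic, whose domain can be shifted so that it
  starts at \<open>1\<close>: the root of the tree of initial segments carries the whole space.
\<close>
lemma cone_1_eq_UNIV:
  fixes p :: "'a::metric_space"
  assumes "integrally_quasi_geodesic_space TYPE('a) q Q" "g 1 = p"
  shows "cone p q Q g 1 = UNIV"
proof -
  have "x \<in> cone p q Q g 1" for x
  proof -
    obtain D h where D: "integral_quasi_geodesic q Q D h" "finite D" "D \<noteq> {}"
      "h (Min D) = p" "h (Max D) = x"
      using assms(1) unfolding integrally_quasi_geodesic_space_def by blast
    have le: "1 \<le> Min D" "Min D \<le> Max D"
      using D integral_interval_ge_1 by (auto simp: integral_quasi_geodesic_def)
    define n where "n = Max D - Min D + 1"
    define h' where "h' = (\<lambda>j. h (Min D + j - 1))"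
    have mem: "Min D + j - 1 \<in> D" if "j \<in> {1..n}" for j
    proof (rule integral_interval_between[of D "Min D" "Max D"])
      show "integral_interval D"
        using D(1) by (simp add: integral_quasi_geodesic_def)
      show "Min D \<le> Min D + j - 1" "Min D + j - 1 \<le> Max D"
        using that le by (auto simp: n_def simp del: Max_ge Min_le)
    qed (use D in auto)
    have diff: "real (Min D + i - 1) - real (Min D + j - 1) = real i - real j"
      if "i \<in> {1..n}" "j \<in> {1..n}" for i j
      using that by (simp add: of_nat_diff)
    have "integral_quasi_geodesic q Q {1..n} h'"
      unfolding integral_quasi_geodesic_def h'_def
      using integral_interval_atLeastAtMost_1 integral_quasi_geodesic_bounds[OF D(1) mem mem]
      by (simp add: diff)
    moreover have "1 \<le> n" "h' 1 = p"
      using D(4) by (simp_all add: n_def h'_def)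
    ultimately have "h' n \<in> cone p q Q g 1"
      using assms(2) by (intro mem_coneI[of q Q "{1..n}"]) (auto simp: le_Suc_eq)
    moreover have "h' n = x"
      using D le by (simp add: h'_def n_def)
    ultimately show ?thesis by simp
  qed
  then show ?thesis by blast
qed

text \<open>
  A quasi-geodesic that follows \<open>g\<close> up to time \<open>m\<close> either stops there or takes a next step, and
  that step stays in a ball about \<open>p\<close> whose radius depends only on \<open>m\<close>. In a space with finite
  balls this makes the tree of initial segments finitely branching.
\<close>
lemma cone_subset_successors:
  assumes "1 \<le> m"
  shows "cone p q Q g m \<subseteq>
    insert (g m) (\<Union>y\<in>cball p (q * real m + Q). cone p q Q (g(Suc m := y)) (Suc m))"
proof
  fix x assume "x \<in> cone p q Q g m"
  then obtain D h i where h: "integral_quasi_geodesic q Q D h" "1 \<in> D" "h 1 = p"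
    "\<And>j. 1 \<le> j \<Longrightarrow> j \<le> m \<Longrightarrow> j \<in> D \<and> h j = g j" "i \<in> D" "m \<le> i" "x = h i"
    by (rule mem_coneE) blast
  show "x \<in> insert (g m) (\<Union>y\<in>cball p (q * real m + Q). cone p q Q (g(Suc m := y)) (Suc m))"
  proof (cases "i = m")
    case True
    then show ?thesis using h assms by simp
  next
    case False
    then have "Suc m \<in> D"
      using h integral_interval_between[of D 1 i "Suc m"]
      by (auto simp: integral_quasi_geodesic_def)
    then have "h (Suc m) \<in> cball p (q * real m + Q)"
      using integral_quasi_geodesic_bounds(2)[OF h(1) h(2), of "Suc m"] h(3) by simp
    moreover have "x \<in> cone p q Q (g(Suc m := h (Suc m))) (Suc m)"
      unfolding \<open>x = h i\<close>
      by (rule mem_coneI) (use h False in \<open>auto simp: le_Suc_eq\<close>)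
    ultimately show ?thesis by blast
  qed
qed

lemma eventually_not_mem_cone:
  fixes p a :: "'a::metric_space"
  assumes "q \<ge> 1"
  shows "\<forall>\<^sub>F m in sequentially. a \<notin> cone p q Q g m"
proof -
  obtain N :: nat where N: "q * (dist p a + Q) + 1 < real N"
    using reals_Archimedean2 by blast
  have "a \<notin> cone p q Q g m" if "N \<le> m" for m
  proof
    assume "a \<in> cone p q Q g m"
    then obtain D h i where h: "integral_quasi_geodesic q Q D h" "1 \<in> D" "h 1 = p"
      "i \<in> D" "m \<le> i" "a = h i"
      by (rule mem_coneE)
    have "(real i - 1) / q - Q \<le> dist p a"
      using integral_quasi_geodesic_bounds(1)[OF h(1,2,4)] h that integral_interval_ge_1[of D i]
      by (auto simp: integral_quasi_geodesic_def)
    then have "real i - 1 \<le> q * (dist p a + Q)"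
      using assms by (simp add: field_simps)
    then show False
      using N that h by linarith
  qed
  then show ?thesis
    by (auto simp: eventually_sequentially)
qed

text \<open>
  Only the finitely many values of \<open>g\<close> up to \<open>m\<close> matter for the cone; a list records them.
\<close>
lemma countable_cones:
  assumes "countable (UNIV :: 'a::metric_space set)"
  shows "countable {cone (p::'a) q Q g m | g m. True}"
proof -
  have "{cone p q Q g m | g m. True} \<subseteq>
          (\<lambda>xs. cone p q Q (\<lambda>j. xs ! j) (length xs - 1)) ` lists UNIV"
  proof clarsimp
    fix g m
    \<comment> \<open>The entry with index \<open>0\<close> is padding, because quasi-geodesics start at time \<open>1\<close>.\<close>
    have "cone p q Q g m = cone p q Q (\<lambda>j. map g [0..<Suc m] ! j) m"
      by (rule cone_cong) (simp del: upt_Suc)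
    then show "cone p q Q g m \<in> range (\<lambda>xs. cone p q Q (\<lambda>j. xs ! j) (length xs - Suc 0))"
      by (intro image_eqI[where x = "map g [0..<Suc m]"]) (auto simp del: upt_Suc)
  qed
  then show ?thesis
    by (rule countable_subset) (intro countable_image countable_lists assms)
qed

section \<open>Geometrically slowly-oscillating functions\<close>

text \<open>
  The diameter condition in the form in which it is used: as an eventual smallness of increments,
  several such conditions can be combined.
\<close>
lemma C_QG_eventually_small_on_cone:
  assumes "f \<in> C_QG" "k \<ge> 1" "integral_quasi_geodesic_ray k k g" "originates_at {1..} g p" "\<epsilon> > 0"
  shows "\<forall>\<^sub>F m in sequentially.
    \<forall>x\<in>cone p k k g m. \<forall>y\<in>cone p k k g m. cmod (f x - f y) < \<epsilon>"
proof -
  have f: "bounded (range f)"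
    and "\<exists>m\<ge>1. diameter (f ` cone p k k g m) < \<epsilon>"
    using assms unfolding C_QG_def geometrically_slowly_oscillating_def by auto
  then obtain M where M: "diameter (f ` cone p k k g M) < \<epsilon>"
    by blast
  have "cmod (f x - f y) < \<epsilon>" if "M \<le> m" "x \<in> cone p k k g m" "y \<in> cone p k k g m" for m x y
  proof -
    have "bounded (f ` cone p k k g M)"
      by (rule bounded_subset[OF f]) auto
    moreover have "x \<in> cone p k k g M" "y \<in> cone p k k g M"
      using that cone_antimono by blast+
    ultimately show ?thesis
      using diameter_bounded_bound[of "f ` cone p k k g M" "f x" "f y"] M by (simp add: dist_norm)
  qed
  then show ?thesis
    by (auto simp: eventually_sequentially)
qed

text \<open>
  Conversely, increments below \<open>\<epsilon>/2\<close> keep the diameter, a supremum, strictly below \<open>\<epsilon>\<close>.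
\<close>
lemma C_QG_I:
  assumes "bounded (range f)" "continuous_on UNIV f" "slowly_oscillating f"
    and "\<And>\<epsilon> k p g. \<lbrakk>\<epsilon> > 0; k \<ge> 1; integral_quasi_geodesic_ray k k g; originates_at {1..} g p\<rbrakk>
      \<Longrightarrow> \<forall>\<^sub>F m in sequentially.
            \<forall>x\<in>cone p k k g m. \<forall>y\<in>cone p k k g m. cmod (f x - f y) < \<epsilon>"
  shows "f \<in> C_QG"
proof -
  have "\<exists>m\<ge>1. diameter (f ` cone p k k g m) < \<epsilon>"
    if "\<epsilon> > 0" "k \<ge> 1" "integral_quasi_geodesic_ray k k g" "originates_at {1..} g p" for \<epsilon> k p g
  proof -
    have "\<forall>\<^sub>F m in sequentially.
        1 \<le> m \<and> (\<forall>x\<in>cone p k k g m. \<forall>y\<in>cone p k k g m. cmod (f x - f y) < \<epsilon>/2)"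
      using assms(4)[of "\<epsilon>/2", OF _ that(2-4)] \<open>\<epsilon> > 0\<close>
      by (intro eventually_conj eventually_ge_at_top) auto
    from eventually_happens'[OF sequentially_bot this] obtain m where "1 \<le> m"
      and m: "\<forall>x\<in>cone p k k g m. \<forall>y\<in>cone p k k g m. cmod (f x - f y) < \<epsilon>/2"
      by blast
    have "diameter (f ` cone p k k g m) \<le> \<epsilon>/2"
      by (rule diameter_le) (use m \<open>\<epsilon> > 0\<close> in \<open>auto intro: less_imp_le\<close>)
    then show ?thesis
      using \<open>1 \<le> m\<close> \<open>\<epsilon> > 0\<close> by (intro exI[of _ m]) auto
  qed
  then show ?thesis
    using assms unfolding C_QG_def geometrically_slowly_oscillating_def by auto
qed

text \<open>
  Apart from boundedness, membership in \<open>C_QG\<close> only asks that certain increments of \<open>f\<close> become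
  small, so it passes to any bounded function whose increments are dominated by those of members.
  All algebraic closure properties of \<open>C_QG\<close> are instances.
\<close>
lemma C_QG_dominated:
  fixes h :: "'a::metric_space \<Rightarrow> complex"
  assumes "finite F" "F \<subseteq> C_QG" "bounded (range h)"
    and dom: "\<And>x y. cmod (h x - h y) \<le> C * (\<Sum>f\<in>F. cmod (f x - f y))"
  shows "h \<in> C_QG"
proof (rule C_QG_I)
  show "continuous_on UNIV h"
    unfolding continuous_on_def
  proof
    fix x :: 'a
    have "((\<lambda>y. C * (\<Sum>f\<in>F. cmod (f y - f x))) \<longlongrightarrow> C * (\<Sum>f\<in>F. cmod (f x - f x))) (at x)"
      using assms(2) by (intro tendsto_intros)
        (auto simp: C_QG_def geometrically_slowly_oscillating_def continuous_on_def)
    then have *: "((\<lambda>y. C * (\<Sum>f\<in>F. cmod (f y - f x))) \<longlongrightarrow> 0) (at x)"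
      by simp
    have "((\<lambda>y. h y - h x) \<longlongrightarrow> 0) (at x)"
      by (rule Lim_null_comparison[OF always_eventually *]) (rule allI, rule dom)
    then show "(h \<longlongrightarrow> h x) (at x)"
      using LIM_zero_cancel by blast
  qed
  show "slowly_oscillating h"
    unfolding slowly_oscillating_def
  proof (intro allI impI)
    fix xs ys :: "nat \<Rightarrow> 'a" and M
    assume *: "tends_to_infinity xs \<and> 0 < M \<and> (\<forall>n. dist (xs n) (ys n) < M)"
    have "(\<lambda>n. cmod (f (xs n) - f (ys n))) \<longlonglongrightarrow> 0" if "f \<in> F" for f
      using * that assms(2)
      by (auto simp: C_QG_def geometrically_slowly_oscillating_def slowly_oscillating_def)
    then have "(\<lambda>n. C * (\<Sum>f\<in>F. cmod (f (xs n) - f (ys n)))) \<longlonglongrightarrow> C * (\<Sum>f\<in>F. 0)"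
      by (intro tendsto_intros)
    then have **: "(\<lambda>n. C * (\<Sum>f\<in>F. cmod (f (xs n) - f (ys n)))) \<longlonglongrightarrow> 0"
      by simp
    show "(\<lambda>n. cmod (h (xs n) - h (ys n))) \<longlonglongrightarrow> 0"
      by (rule Lim_null_comparison[OF always_eventually **]) (simp add: dom)
  qed
  fix \<epsilon> k :: real and p and g :: "nat \<Rightarrow> 'a"
  assume "\<epsilon> > 0" and g: "k \<ge> 1" "integral_quasi_geodesic_ray k k g" "originates_at {1..} g p"
  \<comment> \<open>The absolute value and the added \<open>1\<close> keep the denominator positive for every \<open>C\<close> and \<open>F\<close>.\<close>
  define \<delta> where "\<delta> = \<epsilon> / ((\<bar>C\<bar> + 1) * (real (card F) + 1))"
  have "\<delta> > 0"
    using \<open>\<epsilon> > 0\<close> by (auto simp: \<delta>_def intro!: divide_pos_pos mult_pos_pos)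
  have "\<forall>\<^sub>F m in sequentially. \<forall>f\<in>F.
      \<forall>x\<in>cone p k k g m. \<forall>y\<in>cone p k k g m. cmod (f x - f y) < \<delta>"
    using assms(2) g \<open>\<delta> > 0\<close> C_QG_eventually_small_on_cone
    by (intro eventually_ball_finite \<open>finite F\<close> ballI) blast
  then show "\<forall>\<^sub>F m in sequentially.
      \<forall>x\<in>cone p k k g m. \<forall>y\<in>cone p k k g m. cmod (h x - h y) < \<epsilon>"
  proof (rule eventually_mono, intro ballI)
    fix m x y
    assume small: "\<forall>f\<in>F. \<forall>x\<in>cone p k k g m. \<forall>y\<in>cone p k k g m. cmod (f x - f y) < \<delta>"
      and xy: "x \<in> cone p k k g m" "y \<in> cone p k k g m"
    have "(\<Sum>f\<in>F. cmod (f x - f y)) \<le> real (card F) * \<delta>"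
      using small xy by (intro sum_bounded_above) (auto intro: less_imp_le)
    also have "\<dots> < (real (card F) + 1) * \<delta>"
      using \<open>\<delta> > 0\<close> by simp
    finally have "(\<Sum>f\<in>F. cmod (f x - f y)) < (real (card F) + 1) * \<delta>" .
    then have "(\<bar>C\<bar> + 1) * (\<Sum>f\<in>F. cmod (f x - f y)) < (\<bar>C\<bar> + 1) * ((real (card F) + 1) * \<delta>)"
      by (intro mult_strict_left_mono) auto
    also have "\<dots> = \<epsilon>"
      by (simp add: \<delta>_def)
    moreover have "C * (\<Sum>f\<in>F. cmod (f x - f y)) \<le> (\<bar>C\<bar> + 1) * (\<Sum>f\<in>F. cmod (f x - f y))"
      by (intro mult_right_mono sum_nonneg) auto
    ultimately show "cmod (h x - h y) < \<epsilon>"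
      using dom[of x y] by linarith
  qed
qed fact

lemma C_QG_dominated1:
  assumes "f \<in> C_QG" "bounded (range h)" "\<And>x y. cmod (h x - h y) \<le> C * cmod (f x - f y)"
  shows "h \<in> C_QG"
  using C_QG_dominated[of "{f}" h C] assms by simp

lemma C_QG_dominated2:
  assumes "f \<in> C_QG" "g \<in> C_QG" "bounded (range h)" "C \<ge> 0"
    and dom: "\<And>x y. cmod (h x - h y) \<le> C * (cmod (f x - f y) + cmod (g x - g y))"
  shows "h \<in> C_QG"
proof (rule C_QG_dominated)
  fix x y
  have "cmod (f x - f y) + cmod (g x - g y) \<le> 2 * (\<Sum>f\<in>{f, g}. cmod (f x - f y))"
    by (cases "f = g") auto
  then have "C * (cmod (f x - f y) + cmod (g x - g y)) \<le> C * (2 * (\<Sum>f\<in>{f, g}. cmod (f x - f y)))"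
    using \<open>C \<ge> 0\<close> by (rule mult_left_mono)
  then show "cmod (h x - h y) \<le> (C * 2) * (\<Sum>f\<in>{f, g}. cmod (f x - f y))"
    using dom[of x y] by linarith
qed (use assms in auto)

lemma C_QG_bound:
  assumes "f \<in> C_QG"
  obtains B where "B \<ge> 0" "\<And>x. cmod (f x) \<le> B"
proof -
  obtain B where "\<And>x. cmod (f x) \<le> B"
    using assms unfolding C_QG_def geometrically_slowly_oscillating_def bounded_iff by auto
  then show ?thesis
    using that[of B] norm_ge_zero order_trans by blast
qed

lemma C_QG_const: "(\<lambda>x. c) \<in> C_QG"
  by (rule C_QG_dominated[of "{}"]) auto

lemma C_QG_add:
  assumes f: "f \<in> C_QG" and g: "g \<in> C_QG"
  shows "(\<lambda>x. f x + g x) \<in> C_QG"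
proof -
  obtain A B where "\<And>x. cmod (f x) \<le> A" "\<And>x. cmod (g x) \<le> B"
    using f g C_QG_bound by metis
  then have "bounded (range (\<lambda>x. f x + g x))"
    unfolding bounded_iff by (intro exI[of _ "A + B"]) (auto intro: norm_triangle_mono)
  moreover have "cmod (f x + g x - (f y + g y)) \<le> 1 * (cmod (f x - f y) + cmod (g x - g y))" for x y
    using norm_triangle_ineq[of "f x - f y" "g x - g y"] by (simp add: algebra_simps)
  ultimately show ?thesis
    by (rule C_QG_dominated2[OF f g _ zero_le_one])
qed

lemma C_QG_mult:
  assumes f: "f \<in> C_QG" and g: "g \<in> C_QG"
  shows "(\<lambda>x. f x * g x) \<in> C_QG"
proof -
  obtain A B where A: "A \<ge> 0" "\<And>x. cmod (f x) \<le> A" and B: "B \<ge> 0" "\<And>x. cmod (g x) \<le> B"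
    using f g C_QG_bound by metis
  then have "bounded (range (\<lambda>x. f x * g x))"
    unfolding bounded_iff by (intro exI[of _ "A * B"]) (auto simp: norm_mult intro!: mult_mono)
  moreover have "cmod (f x * g x - f y * g y) \<le> (A + B) * (cmod (f x - f y) + cmod (g x - g y))" for x y
  proof -
    have "f x * g x - f y * g y = f x * (g x - g y) + g y * (f x - f y)"
      by (simp add: algebra_simps)
    also have "cmod \<dots> \<le> cmod (f x) * cmod (g x - g y) + cmod (g y) * cmod (f x - f y)"
      by (metis norm_mult norm_triangle_ineq)
    also have "\<dots> \<le> A * cmod (g x - g y) + B * cmod (f x - f y)"
      using A B by (intro add_mono mult_right_mono) auto
    also have "\<dots> \<le> (A + B) * (cmod (f x - f y) + cmod (g x - g y))"
      using A B by (simp add: algebra_simps)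
    finally show ?thesis .
  qed
  ultimately show ?thesis
    using A(1) B(1) by (intro C_QG_dominated2[OF f g, where C = "A + B"]) simp_all
qed

lemma C_QG_cnj:
  assumes f: "f \<in> C_QG"
  shows "(\<lambda>x. cnj (f x)) \<in> C_QG"
proof (rule C_QG_dominated1[OF f])
  show "bounded (range (\<lambda>x. cnj (f x)))"
    using C_QG_bound[OF f] unfolding bounded_iff by (metis complex_mod_cnj rangeE)
  show "cmod (cnj (f x) - cnj (f y)) \<le> 1 * cmod (f x - f y)" for x y
    by (metis complex_cnj_diff complex_mod_cnj mult_1 order_refl)
qed

lemma C_QG_inverse:
  assumes f: "f \<in> C_QG" and "\<delta> > 0" and \<delta>: "\<And>x. \<delta> \<le> cmod (f x)"
  shows "(\<lambda>x. inverse (f x)) \<in> C_QG"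
proof (rule C_QG_dominated1[OF f])
  have inv: "cmod (inverse (f x)) \<le> inverse \<delta>" and nz: "f x \<noteq> 0" for x
    using \<delta>[of x] \<open>\<delta> > 0\<close> by (auto simp: norm_inverse intro: le_imp_inverse_le)
  show "bounded (range (\<lambda>x. inverse (f x)))"
    using inv unfolding bounded_iff by blast
  show "cmod (inverse (f x) - inverse (f y)) \<le> (inverse \<delta> * inverse \<delta>) * cmod (f x - f y)" for x y
  proof -
    have "inverse (f x) - inverse (f y) = - (inverse (f x) * inverse (f y) * (f x - f y))"
      using nz[of x] nz[of y] by (simp add: field_simps)
    then have "cmod (inverse (f x) - inverse (f y))
        = cmod (inverse (f x)) * cmod (inverse (f y)) * cmod (f x - f y)"
      by (simp add: norm_mult)
    also have "\<dots> \<le> (inverse \<delta> * inverse \<delta>) * cmod (f x - f y)"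
      using inv \<open>\<delta> > 0\<close> by (intro mult_right_mono mult_mono) auto
    finally show ?thesis .
  qed
qed

text \<open>
  Escaping sequences and far cones leave every point behind, so its indicator passes the two
  oscillation tests trivially; discreteness makes it continuous. These functions detect the
  points of \<open>X\<close> inside \<open>X_QG\<close>.
\<close>
lemma C_QG_indicator_point:
  fixes a :: "'a::metric_space"
  assumes "discrete (UNIV :: 'a set)"
  shows "indicator {a} \<in> (C_QG :: ('a \<Rightarrow> complex) set)"
proof (rule C_QG_I)
  show "bounded (range (indicator {a} :: 'a \<Rightarrow> complex))"
    unfolding bounded_iff by (intro exI[of _ 1]) (auto simp: indicator_def)
  show "continuous_on UNIV (indicator {a} :: 'a \<Rightarrow> complex)"
    by (rule continuous_on_discrete[OF assms])
  show "slowly_oscillating (indicator {a} :: 'a \<Rightarrow> complex)"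
    unfolding slowly_oscillating_def
  proof (intro allI impI)
    fix xs ys :: "nat \<Rightarrow> 'a" and M
    assume *: "tends_to_infinity xs \<and> 0 < M \<and> (\<forall>n. dist (xs n) (ys n) < M)"
    then have "\<forall>\<^sub>F n in sequentially. dist a (xs n) \<ge> M"
      unfolding tends_to_infinity_def filterlim_at_top by blast
    then have "\<forall>\<^sub>F n in sequentially. 0 = cmod (indicator {a} (xs n) - indicator {a} (ys n))"
    proof (rule eventually_mono)
      fix n assume "dist a (xs n) \<ge> M"
      moreover have "dist (xs n) (ys n) < M" "0 < M"
        using * by auto
      ultimately have "xs n \<noteq> a" "ys n \<noteq> a"
        by (auto simp: dist_commute)
      then show "0 = cmod (indicator {a} (xs n) - indicator {a} (ys n))"
        by simp
    qed
    then show "(\<lambda>n. cmod (indicator {a} (xs n) - indicator {a} (ys n))) \<longlonglongrightarrow> 0"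
      by (rule tendsto_cong[THEN iffD1]) simp
  qed
  fix \<epsilon> k :: real and p and g :: "nat \<Rightarrow> 'a"
  assume "\<epsilon> > 0" "k \<ge> 1"
  from eventually_not_mem_cone[OF \<open>k \<ge> 1\<close>, of a p k g]
  show "\<forall>\<^sub>F m in sequentially. \<forall>x\<in>cone p k k g m. \<forall>y\<in>cone p k k g m.
          cmod (indicator {a} x - indicator {a} y) < \<epsilon>"
    by (rule eventually_mono) (use \<open>\<epsilon> > 0\<close> in \<open>auto simp: indicator_def\<close>)
qed

section \<open>Characters and the compactification\<close>

lemma point_QG_apply: "f \<in> C_QG \<Longrightarrow> point_QG x f = f x"
  by (simp add: point_QG_def)

lemma point_QG_character: "point_QG x \<in> characters C_QG"
proof -
  have "(\<lambda>x. c * f x) \<in> C_QG" if "f \<in> C_QG" for c and f :: "'a \<Rightarrow> complex"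
    using C_QG_mult[OF C_QG_const that] .
  moreover have "\<exists>f\<in>C_QG. point_QG x f \<noteq> 0"
    by (rule bexI[OF _ C_QG_const[of 1]]) (simp add: point_QG_apply C_QG_const)
  ultimately show ?thesis
    by (simp add: characters_def point_QG_apply C_QG_add C_QG_mult) (simp add: point_QG_def)
qed

lemma topspace_X_QG: "topspace X_QG = characters C_QG"
  by (auto simp: X_QG_def maximal_ideal_space_def characters_def PiE_def)

lemma Hausdorff_space_X_QG: "Hausdorff_space X_QG"
  unfolding X_QG_def maximal_ideal_space_def
  by (intro Hausdorff_space_subtopology) (simp add: Hausdorff_space_product_topology)

lemma continuous_map_X_QG_eval: "f \<in> C_QG \<Longrightarrow> continuous_map X_QG euclidean (\<lambda>\<phi>. \<phi> f)"
  unfolding X_QG_def maximal_ideal_space_def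
  by (intro continuous_map_from_subtopology continuous_map_product_projection)

lemma
  assumes "\<phi> \<in> characters C_QG"
  shows character_add: "\<lbrakk>f \<in> C_QG; g \<in> C_QG\<rbrakk> \<Longrightarrow> \<phi> (\<lambda>x. f x + g x) = \<phi> f + \<phi> g"
    and character_mult: "\<lbrakk>f \<in> C_QG; g \<in> C_QG\<rbrakk> \<Longrightarrow> \<phi> (\<lambda>x. f x * g x) = \<phi> f * \<phi> g"
    and character_scale: "f \<in> C_QG \<Longrightarrow> \<phi> (\<lambda>x. c * f x) = c * \<phi> f"
  using assms by (auto simp: characters_def)

lemma character_const:
  fixes \<phi> :: "('a::metric_space \<Rightarrow> complex) \<Rightarrow> complex"
  assumes "\<phi> \<in> characters C_QG"
  shows "\<phi> (\<lambda>x. c) = c"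
proof -
  obtain f where f: "f \<in> C_QG" "\<phi> f \<noteq> 0"
    using assms by (auto simp: characters_def)
  have "\<phi> f = \<phi> (\<lambda>x. 1) * \<phi> f"
    using character_mult[OF assms C_QG_const[of 1] f(1)] by simp
  then have "\<phi> (\<lambda>x. 1) = 1"
    using f by simp
  then show ?thesis
    using character_scale[OF assms C_QG_const[of 1], of c] by simp
qed

lemma character_sum:
  fixes \<phi> :: "('a::metric_space \<Rightarrow> complex) \<Rightarrow> complex"
  assumes "\<phi> \<in> characters C_QG" "finite F" "\<And>f. f \<in> F \<Longrightarrow> h f \<in> C_QG"
  shows "(\<lambda>x. \<Sum>f\<in>F. h f x) \<in> C_QG \<and> \<phi> (\<lambda>x. \<Sum>f\<in>F. h f x) = (\<Sum>f\<in>F. \<phi> (h f))"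
  using assms(2,3)
proof (induction F rule: finite_induct)
  case empty
  then show ?case by (simp add: C_QG_const character_const[OF assms(1)])
next
  case (insert f F)
  then show ?case
    by (simp add: C_QG_add character_add[OF assms(1)])
qed

text \<open>
  If no point were near \<open>\<phi>\<close>, then \<open>s = \<Sum> \<bar>f - \<phi> f\<bar>\<^sup>2\<close> would be bounded below by \<open>\<epsilon>\<^sup>2\<close>, hence
  invertible in \<open>C_QG\<close>, although \<open>\<phi> s = 0\<close>. The squares are written as
  \<open>d f * cnj (d f)\<close> with \<open>\<phi> (d f) = 0\<close>, so that the multiplicative \<open>\<phi>\<close> vanishes on each of them.
\<close>
lemma character_near_point:
  fixes \<phi> :: "('a::metric_space \<Rightarrow> complex) \<Rightarrow> complex"
  assumes \<phi>: "\<phi> \<in> characters C_QG" and "finite F" "F \<subseteq> C_QG" "\<epsilon> > 0"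
  shows "\<exists>x. \<forall>f\<in>F. cmod (f x - \<phi> f) < \<epsilon>"
proof (rule ccontr)
  assume far: "\<not> ?thesis"
  define d where "d f x = f x - \<phi> f" for f x
  define s where "s x = (\<Sum>f\<in>F. d f x * cnj (d f x))" for x
  have d: "d f \<in> C_QG" "\<phi> (d f) = 0" if "f \<in> C_QG" for f
  proof -
    have eq: "d f = (\<lambda>x. f x + (- \<phi> f))"
      by (simp add: d_def fun_eq_iff)
    show "d f \<in> C_QG" "\<phi> (d f) = 0"
      unfolding eq
      using C_QG_add[OF that C_QG_const[of "- \<phi> f"]]
        character_add[OF \<phi> that C_QG_const[of "- \<phi> f"]]
      by (simp_all add: character_const[OF \<phi>])
  qed
  have mem: "(\<lambda>x. d f x * cnj (d f x)) \<in> C_QG" if "f \<in> F" for f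
    using that assms(3) by (intro C_QG_mult C_QG_cnj d) auto
  have "\<phi> (\<lambda>x. d f x * cnj (d f x)) = 0" if "f \<in> F" for f
    using that assms(3) d[of f] by (subst character_mult[OF \<phi>]) (auto intro: C_QG_cnj)
  with mem have s: "s \<in> C_QG" "\<phi> s = 0"
    using character_sum[OF \<phi> \<open>finite F\<close>, of "\<lambda>f x. d f x * cnj (d f x)"]
    unfolding s_def[abs_def] by auto
  have lower: "\<epsilon>\<^sup>2 \<le> cmod (s x)" for x
  proof -
    obtain f where "f \<in> F" "\<epsilon> \<le> cmod (d f x)"
      using far by (auto simp: d_def not_less)
    then have "\<epsilon>\<^sup>2 \<le> (cmod (d f x))\<^sup>2"
      using \<open>\<epsilon> > 0\<close> by (intro power_mono) auto
    also have "\<dots> \<le> (\<Sum>f\<in>F. (cmod (d f x))\<^sup>2)"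
      using \<open>f \<in> F\<close> \<open>finite F\<close> by (intro member_le_sum) auto
    also have "\<dots> = Re (s x)"
      by (simp add: s_def complex_norm_square[symmetric] flip: of_real_power)
    also have "\<dots> \<le> cmod (s x)"
      by (rule complex_Re_le_cmod)
    finally show ?thesis .
  qed
  then have nz: "s x \<noteq> 0" for x
    using \<open>\<epsilon> > 0\<close> by (metis norm_zero not_le zero_less_power)
  have "(\<lambda>x. inverse (s x)) \<in> C_QG"
    using C_QG_inverse[OF s(1) _ lower] \<open>\<epsilon> > 0\<close> by simp
  then have "\<phi> (\<lambda>x. s x * inverse (s x)) = 0"
    using character_mult[OF \<phi> s(1)] s(2) by simp
  then show False
    using nz character_const[OF \<phi>, of 1] by simp
qed

lemma X_QG_closure_of_points: "X_QG closure_of (range point_QG) = topspace X_QG"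
proof (intro equalityI closure_of_subset_topspace subsetI)
  fix \<phi> :: "('a \<Rightarrow> complex) \<Rightarrow> complex" assume \<phi>: "\<phi> \<in> topspace X_QG"
  show "\<phi> \<in> X_QG closure_of (range point_QG)"
    unfolding in_closure_of
  proof (intro conjI \<phi> allI impI)
    fix T :: "(('a \<Rightarrow> complex) \<Rightarrow> complex) set" assume T: "\<phi> \<in> T \<and> openin X_QG T"
    then obtain U where U: "openin (product_topology (\<lambda>_. euclidean) C_QG) U"
        "T = U \<inter> characters C_QG"
      unfolding X_QG_def maximal_ideal_space_def openin_subtopology by blast
    then obtain V where V: "\<phi> \<in> (\<Pi>\<^sub>E f\<in>C_QG. V f)" "\<And>f. open (V f)" "finite {f. V f \<noteq> UNIV}"
        "(\<Pi>\<^sub>E f\<in>C_QG. V f) \<subseteq> U"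
      using T product_topology_open_contains_basis[OF U(1), of \<phi>] by auto
    define F where "F = {f. V f \<noteq> UNIV} \<inter> C_QG"
    have "finite F" "F \<subseteq> C_QG"
      using V by (auto simp: F_def)
    have "\<forall>f\<in>F. \<forall>\<^sub>F e in at_right 0. ball (\<phi> f) e \<subseteq> V f"
    proof
      fix f assume "f \<in> F"
      then have "\<phi> f \<in> V f"
        using V(1) by (auto simp: F_def)
      then obtain e where "e > 0" "ball (\<phi> f) e \<subseteq> V f"
        using V(2) open_contains_ball by blast
      then show "\<forall>\<^sub>F e in at_right 0. ball (\<phi> f) e \<subseteq> V f"
        by (intro eventually_at_right_less[of 0, THEN eventually_mono] eventually_at_rightI[of 0 e])
          (auto intro: order_trans[OF subset_ball])
    qed
    then have "\<forall>\<^sub>F e in at_right 0. 0 < e \<and> (\<forall>f\<in>F. ball (\<phi> f) e \<subseteq> V f)"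
      using \<open>finite F\<close> by (intro eventually_conj eventually_at_right_less eventually_ball_finite)
    from eventually_happens'[OF trivial_limit_at_right_real this]
    obtain e :: real where e: "0 < e" "\<And>f. f \<in> F \<Longrightarrow> ball (\<phi> f) e \<subseteq> V f"
      by blast
    obtain x where x: "\<forall>f\<in>F. cmod (f x - \<phi> f) < e"
      using character_near_point[OF _ \<open>finite F\<close> \<open>F \<subseteq> C_QG\<close> \<open>0 < e\<close>] \<phi>
      by (auto simp: topspace_X_QG)
    have "point_QG x f \<in> V f" if "f \<in> C_QG" for f
    proof (cases "f \<in> F")
      case True
      then have "cmod (f x - \<phi> f) < e"
        using x by blast
      then have "f x \<in> ball (\<phi> f) e"
        by (simp add: dist_norm norm_minus_commute)
      then show ?thesis
        using subsetD[OF e(2)[OF True]] that by (simp add: point_QG_apply)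
    qed (use that in \<open>auto simp: F_def\<close>)
    then have "point_QG x \<in> (\<Pi>\<^sub>E f\<in>C_QG. V f)"
      by (auto simp: point_QG_def)
    then have "point_QG x \<in> T"
      using V(4) U(2) point_QG_character by blast
    then show "\<exists>y. y \<in> range point_QG \<and> y \<in> T"
      by blast
  qed
qed

text \<open>
  The transfer from \<open>X\<close> to \<open>X_QG\<close>: evaluation at \<open>f\<close> is continuous, so \<open>f\<close> oscillates no more on
  the closure of \<open>S\<close> than on \<open>S\<close>.
\<close>
lemma closure_eval_small:
  assumes "\<phi> \<in> X_QG closure_of (point_QG ` S)" "\<psi> \<in> X_QG closure_of (point_QG ` S)"
    and f: "f \<in> C_QG" and S: "\<And>x y. \<lbrakk>x \<in> S; y \<in> S\<rbrakk> \<Longrightarrow> cmod (f x - f y) < \<epsilon>"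
  shows "cmod (\<phi> f - \<psi> f) \<le> \<epsilon>"
proof -
  have *: "\<theta> f \<in> closure (f ` S)" if "\<theta> \<in> X_QG closure_of (point_QG ` S)" for \<theta>
  proof -
    have "\<theta> f \<in> (\<lambda>\<theta>. \<theta> f) ` (X_QG closure_of (point_QG ` S))"
      using that by blast
    also have "\<dots> \<subseteq> closure ((\<lambda>\<theta>. \<theta> f) ` point_QG ` S)"
      using continuous_map_image_closure_subset[OF continuous_map_X_QG_eval[OF f]] by simp
    also have "(\<lambda>\<theta>. \<theta> f) ` point_QG ` S = f ` S"
      using f by (simp add: image_image point_QG_apply)
    finally show ?thesis .
  qed
  show ?thesis
  proof (rule field_le_epsilon)
    fix e :: real assume "e > 0"
    obtain x where x: "x \<in> S" "dist (f x) (\<phi> f) < e/2"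
      using *[OF assms(1), unfolded closure_approachable, rule_format, of "e/2"] \<open>e > 0\<close> by auto
    obtain y where y: "y \<in> S" "dist (f y) (\<psi> f) < e/2"
      using *[OF assms(2), unfolded closure_approachable, rule_format, of "e/2"] \<open>e > 0\<close> by auto
    have "dist (\<phi> f) (\<psi> f) \<le> dist (f x) (\<phi> f) + (dist (f x) (f y) + dist (f y) (\<psi> f))"
      using dist_triangle[of "\<phi> f" "\<psi> f" "f x"] dist_triangle[of "f x" "\<psi> f" "f y"]
      by (simp add: dist_commute)
    then show "cmod (\<phi> f - \<psi> f) \<le> \<epsilon> + e"
      using S[OF x(1) y(1)] x(2) y(2) by (simp add: dist_norm)
  qed
qed

text \<open>
  Replacing the existential condition \<open>\<phi> \<noteq> 0\<close> by \<open>\<phi> 1 = 1\<close> describes the characters by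
  equations between continuous functions of \<open>\<phi>\<close>, so that they form a closed set.
\<close>
lemma characters_eq:
  "characters C_QG = {\<phi> \<in> extensional C_QG.
     (\<forall>f\<in>C_QG. \<forall>g\<in>C_QG. \<phi> (\<lambda>x. f x + g x) = \<phi> f + \<phi> g) \<and>
     (\<forall>c. \<forall>f\<in>C_QG. \<phi> (\<lambda>x. c * f x) = c * \<phi> f) \<and>
     (\<forall>f\<in>C_QG. \<forall>g\<in>C_QG. \<phi> (\<lambda>x. f x * g x) = \<phi> f * \<phi> g) \<and> \<phi> (\<lambda>x. 1) = 1}"
  (is "?L = ?R")
proof (intro equalityI subsetI)
  fix \<phi> :: "('a \<Rightarrow> complex) \<Rightarrow> complex" assume \<phi>: "\<phi> \<in> ?L"
  then have "\<phi> (\<lambda>x. 1) = 1"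
    by (rule character_const)
  with \<phi> show "\<phi> \<in> ?R"
    unfolding characters_def by blast
next
  fix \<phi> :: "('a \<Rightarrow> complex) \<Rightarrow> complex" assume \<phi>: "\<phi> \<in> ?R"
  then have "\<phi> (\<lambda>x. 1) \<noteq> 0"
    by simp
  with \<phi> show "\<phi> \<in> ?L"
    unfolding characters_def using C_QG_const[of 1] by blast
qed

text \<open>
  By density, \<open>\<phi> f\<close> is bounded by any bound of \<open>f\<close>; thus the characters are a closed subset of a
  product of compact discs.
\<close>
lemma compact_space_X_QG: "compact_space X_QG"
proof -
  let ?P = "product_topology (\<lambda>_. euclidean) C_QG :: (('a \<Rightarrow> complex) \<Rightarrow> complex) topology"
  have "\<forall>f :: 'a \<Rightarrow> complex. \<exists>B. f \<in> C_QG \<longrightarrow> (\<forall>x. cmod (f x) \<le> B)"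
    using C_QG_bound by metis
  then obtain B where B: "\<And>(f :: 'a \<Rightarrow> complex) x. f \<in> C_QG \<Longrightarrow> cmod (f x) \<le> B f"
    by metis
  have eval: "continuous_map ?P euclidean (\<lambda>\<phi>. \<phi> f)" if "f \<in> C_QG" for f
    by (rule continuous_map_product_projection[OF that])
  have mult: "continuous_map ?P euclidean (\<lambda>\<phi>. l \<phi> * r \<phi>)"
    if "continuous_map ?P euclidean l" "continuous_map ?P euclidean r"
    for l r :: "(('a \<Rightarrow> complex) \<Rightarrow> complex) \<Rightarrow> complex"
    using that by (simp add: continuous_map_atin tendsto_mult)
  have closed: "closedin ?P {\<phi> \<in> topspace ?P. l \<phi> = r \<phi>}"
    if "continuous_map ?P euclidean l" "continuous_map ?P euclidean r"
    for l r :: "(('a \<Rightarrow> complex) \<Rightarrow> complex) \<Rightarrow> complex"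
    by (rule closedin_continuous_maps_eq) (use that in auto)
  have scale: "(\<lambda>x. c * f x) \<in> C_QG" if "f \<in> C_QG" for c and f :: "'a \<Rightarrow> complex"
    using C_QG_mult[OF C_QG_const that] .
  have topspace_P: "topspace ?P = extensional C_QG"
    by (auto simp: PiE_def)
  have "characters C_QG =
     (\<Inter>f\<in>C_QG. \<Inter>g\<in>C_QG. {\<phi> \<in> topspace ?P. \<phi> (\<lambda>x. f x + g x) = \<phi> f + \<phi> g}) \<inter>
     (\<Inter>c. \<Inter>f\<in>C_QG. {\<phi> \<in> topspace ?P. \<phi> (\<lambda>x. c * f x) = c * \<phi> f}) \<inter>
     (\<Inter>f\<in>C_QG. \<Inter>g\<in>C_QG. {\<phi> \<in> topspace ?P. \<phi> (\<lambda>x. f x * g x) = \<phi> f * \<phi> g}) \<inter>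
     {\<phi> \<in> topspace ?P. \<phi> (\<lambda>x. 1) = 1}"
    (is "_ = ?K")
    unfolding characters_eq topspace_P by blast
  also have "closedin ?P ?K"
    using C_QG_const
    by (intro closedin_Int closedin_INT closed continuous_map_add mult
          eval C_QG_add C_QG_mult scale) auto
  finally have "closedin ?P (characters C_QG)" .
  moreover have "compactin ?P (\<Pi>\<^sub>E f\<in>C_QG. cball 0 (B f))"
    by (simp add: compactin_PiE)
  moreover have "characters C_QG \<subseteq> (\<Pi>\<^sub>E f\<in>C_QG. cball 0 (B f))"
  proof
    fix \<phi> :: "('a \<Rightarrow> complex) \<Rightarrow> complex" assume \<phi>: "\<phi> \<in> characters C_QG"
    have "cmod (\<phi> f) \<le> B f" if "f \<in> C_QG" for f
    proof (rule field_le_epsilon)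
      fix e :: real assume "e > 0"
      then obtain x where "cmod (f x - \<phi> f) < e"
        using character_near_point[OF \<phi>, of "{f}"] \<open>f \<in> C_QG\<close> by auto
      then show "cmod (\<phi> f) \<le> B f + e"
        using B[OF that, of x] norm_triangle_sub[of "\<phi> f" "f x"] by (simp add: norm_minus_commute)
    qed
    then show "\<phi> \<in> (\<Pi>\<^sub>E f\<in>C_QG. cball 0 (B f))"
      using \<phi> by (auto simp: characters_def PiE_def)
  qed
  ultimately have "compactin ?P (characters C_QG)"
    using closed_compactin by blast
  then show ?thesis
    unfolding X_QG_def maximal_ideal_space_def by (rule compact_space_subtopology)
qed

text \<open>
  If \<open>\<phi>\<close> does not vanish on the indicator \<open>e\<close> of \<open>a\<close>, then \<open>\<phi> f * \<phi> e = \<phi> (f * e) = f a * \<phi> e\<close>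
  shows that \<open>\<phi>\<close> is evaluation at \<open>a\<close>.
\<close>
lemma boundary_QG_eq:
  assumes "discrete (UNIV :: 'a::metric_space set)"
  shows "boundary_QG = {\<phi> \<in> topspace X_QG. \<forall>a::'a. \<phi> (indicator {a}) = 0}"
proof -
  note ind = C_QG_indicator_point[OF assms]
  have "\<phi> \<in> range point_QG \<longleftrightarrow> (\<exists>a. \<phi> (indicator {a}) \<noteq> 0)" if \<phi>: "\<phi> \<in> characters C_QG"
    for \<phi> :: "('a \<Rightarrow> complex) \<Rightarrow> complex"
  proof
    assume "\<phi> \<in> range point_QG"
    then show "\<exists>a. \<phi> (indicator {a}) \<noteq> 0"
      using ind by (auto simp: point_QG_apply indicator_def)
  next
    assume "\<exists>a. \<phi> (indicator {a}) \<noteq> 0"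
    then obtain a where a: "\<phi> (indicator {a}) \<noteq> 0" ..
    have "\<phi> f = f a" if "f \<in> C_QG" for f
    proof -
      have "\<phi> f * \<phi> (indicator {a}) = \<phi> (\<lambda>x. f x * indicator {a} x)"
        using character_mult[OF \<phi> that ind] by simp
      also have "(\<lambda>x. f x * indicator {a} x) = (\<lambda>x. f a * indicator {a} x)"
        by (auto simp: indicator_def)
      also have "\<phi> \<dots> = f a * \<phi> (indicator {a})"
        by (rule character_scale[OF \<phi> ind])
      finally show ?thesis using a by simp
    qed
    then have "\<phi> = point_QG a"
      using \<phi> by (intro extensionalityI[of _ C_QG]) (auto simp: characters_def point_QG_def)
    then show "\<phi> \<in> range point_QG" by blast
  qed
  then show ?thesis
    unfolding boundary_QG_def topspace_X_QG by blast
qed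

lemma closedin_boundary_QG:
  assumes "discrete (UNIV :: 'a::metric_space set)"
  shows "closedin X_QG (boundary_QG :: (('a \<Rightarrow> complex) \<Rightarrow> complex) set)"
proof -
  have "boundary_QG = (\<Inter>a::'a. {\<phi> \<in> topspace X_QG. \<phi> (indicator {a}) = 0})"
    unfolding boundary_QG_eq[OF assms] by auto
  also have "closedin X_QG \<dots>"
    using C_QG_indicator_point[OF assms]
    by (intro closedin_INT closedin_continuous_maps_eq[of euclidean] continuous_map_X_QG_eval) auto
  finally show ?thesis .
qed

section \<open>Boundary points and rays\<close>

lemma boundary_point_not_in_closure_of_finite:
  assumes "\<xi> \<in> boundary_QG" "finite S"
  shows "\<xi> \<notin> X_QG closure_of (point_QG ` S)"
proof -
  have "closedin X_QG (point_QG ` S)"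
    using assms point_QG_character
    by (intro closedin_Hausdorff_finite Hausdorff_space_X_QG) (auto simp: topspace_X_QG)
  then show ?thesis
    using assms by (auto simp: closure_of_closedin boundary_QG_def)
qed

text \<open>
  Koenig's argument: starting from the whole space, the initial segment is extended step by step,
  keeping \<open>\<xi>\<close> in the closure of the current cone. The limit is a quasi-geodesic because all of its
  initial segments are restrictions of quasi-geodesics, the cones over them being nonempty.
\<close>
lemma exists_ray_with_boundary_point_in_cone_closures:
  fixes p :: "'a::metric_space"
  assumes geo: "integrally_quasi_geodesic_space TYPE('a) q Q"
    and fin: "\<And>r. finite (cball p r)" and \<xi>: "\<xi> \<in> boundary_QG"
  obtains g where "integral_quasi_geodesic_ray q Q g" "originates_at {1..} g p"
    "\<And>m. 1 \<le> m \<Longrightarrow> \<xi> \<in> X_QG closure_of (point_QG ` cone p q Q g m)"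
proof -
  define P where "P n g \<longleftrightarrow> \<xi> \<in> X_QG closure_of (point_QG ` cone p q Q g (Suc n))" for n g
  \<comment> \<open>\<open>G n\<close> matters only up to time \<open>Suc n\<close>; its remaining values are still to be chosen.\<close>
  have "\<exists>G. \<forall>n. P n (G n) \<and> (\<exists>y. G (Suc n) = (G n)(Suc (Suc n) := y))"
  proof (rule dependent_nat_choice)
    have "cone p q Q (\<lambda>_. p) (Suc 0) = UNIV"
      using cone_1_eq_UNIV[OF geo, of "\<lambda>_. p" p] by simp
    then show "\<exists>g. P 0 g"
      using \<xi> X_QG_closure_of_points unfolding P_def boundary_QG_def by (metis DiffD1)
  next
    fix g n assume "P n g"
    let ?B = "cball p (q * real (Suc n) + Q)"
    let ?c = "\<lambda>y. cone p q Q (g(Suc (Suc n) := y)) (Suc (Suc n))"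
    have "point_QG ` cone p q Q g (Suc n) \<subseteq> point_QG ` {g (Suc n)} \<union> \<Union> ((\<lambda>y. point_QG ` ?c y) ` ?B)"
      using cone_subset_successors[of "Suc n" p q Q g] by auto
    then have "\<xi> \<in> X_QG closure_of (point_QG ` {g (Suc n)} \<union> \<Union> ((\<lambda>y. point_QG ` ?c y) ` ?B))"
      using \<open>P n g\<close> closure_of_mono unfolding P_def by blast
    moreover have "\<xi> \<notin> X_QG closure_of (point_QG ` {g (Suc n)})"
      using boundary_point_not_in_closure_of_finite[OF \<xi>] by blast
    ultimately have "\<exists>y\<in>?B. \<xi> \<in> X_QG closure_of (point_QG ` ?c y)"
      by (simp only: closure_of_Un closure_of_Union[OF finite_imageI[OF fin]]) blast
    then show "\<exists>g'. P (Suc n) g' \<and> (\<exists>y. g' = g(Suc (Suc n) := y))"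
      unfolding P_def by blast
  qed
  then obtain G where P: "\<And>n. P n (G n)" and step: "\<And>n. \<exists>y. G (Suc n) = (G n)(Suc (Suc n) := y)"
    by blast
  \<comment> \<open>The value at time \<open>j\<close> is fixed from \<open>G (j - 1)\<close> on; reading it from \<open>G j\<close> avoids the predecessor.\<close>
  define g where "g j = G j j" for j
  have stable: "G n j = G j j" if "j \<le> n" for n j
    using that
  proof (induction n rule: dec_induct)
    case (step n)
    then show ?case
      using \<open>\<And>n. \<exists>y. G (Suc n) = (G n)(Suc (Suc n) := y)\<close>[of n] by auto
  qed simp
  have G: "G n j = g j" if "1 \<le> j" "j \<le> Suc n" for n j
    using stable[of j n] step[of n] that by (cases "j = Suc n") (auto simp: g_def)
  have cl: "\<xi> \<in> X_QG closure_of (point_QG ` cone p q Q g m)" if "1 \<le> m" for m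
  proof -
    obtain n where n: "m = Suc n"
      using \<open>1 \<le> m\<close> by (cases m) auto
    have "cone p q Q (G n) m = cone p q Q g m"
      by (rule cone_cong) (use G n in auto)
    then show ?thesis
      using P[of n] n by (simp add: P_def)
  qed
  have agree: "\<exists>D h. integral_quasi_geodesic q Q D h \<and> h 1 = p \<and> (\<forall>j\<in>{1..m}. j \<in> D \<and> h j = g j)"
    if "1 \<le> m" for m
  proof -
    have "cone p q Q g m \<noteq> {}"
      using cl[OF that] by (metis closure_of_empty empty_iff image_empty)
    then obtain x where "x \<in> cone p q Q g m"
      by blast
    then show ?thesis
      unfolding cone_def originates_at_def by blast
  qed
  have "integral_quasi_geodesic_ray q Q g"
    unfolding integral_quasi_geodesic_ray_def integral_quasi_geodesic_def
  proof (intro conjI ballI integral_interval_atLeast_1)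
    fix i j :: nat assume ij: "i \<in> {1..}" "j \<in> {1..}"
    then have "1 \<le> max i j"
      by auto
    then obtain D h where h: "integral_quasi_geodesic q Q D h"
      "\<forall>l\<in>{1..max i j}. l \<in> D \<and> h l = g l"
      using agree by blast
    have "i \<in> D" "h i = g i" "j \<in> D" "h j = g j"
      using h(2) ij by auto
    then show "\<bar>real i - real j\<bar> / q - Q \<le> dist (g i) (g j)"
      "dist (g i) (g j) \<le> q * \<bar>real i - real j\<bar> + Q"
      using integral_quasi_geodesic_bounds[OF h(1)] by metis+
  qed
  moreover have "g 1 = p"
    using agree[of 1] by auto
  then have "originates_at {1..} g p"
    by (simp add: originates_at_def)
  ultimately show ?thesis
    using cl that by blast
qed

lemma limitin_X_QG_if_in_cone_closures:
  assumes "k \<ge> 1" "integral_quasi_geodesic_ray k k g" "originates_at {1..} g p"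
    and \<xi>: "\<And>m. 1 \<le> m \<Longrightarrow> \<xi> \<in> X_QG closure_of (point_QG ` cone p k k g m)"
  shows "limitin X_QG (\<lambda>n. point_QG (g n)) \<xi> sequentially"
proof -
  have char: "\<xi> \<in> characters C_QG"
    using \<xi>[of 1] in_closure_of[of \<xi> X_QG] by (auto simp: topspace_X_QG)
  have "(\<lambda>n. f (g n)) \<longlonglongrightarrow> \<xi> f" if f: "f \<in> C_QG" for f
  proof (rule tendstoI)
    fix e :: real assume "e > 0"
    have "\<forall>\<^sub>F m in sequentially. 1 \<le> m \<and>
        (\<forall>x\<in>cone p k k g m. \<forall>y\<in>cone p k k g m. cmod (f x - f y) < e/2)"
      using C_QG_eventually_small_on_cone[OF f assms(1-3), of "e/2"] \<open>e > 0\<close>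
      by (intro eventually_conj eventually_ge_at_top) auto
    then show "\<forall>\<^sub>F n in sequentially. dist (f (g n)) (\<xi> f) < e"
    proof (rule eventually_mono)
      fix m assume m: "1 \<le> m \<and>
        (\<forall>x\<in>cone p k k g m. \<forall>y\<in>cone p k k g m. cmod (f x - f y) < e/2)"
      have "point_QG (g m) \<in> X_QG closure_of (point_QG ` cone p k k g m)"
        using ray_mem_cone[OF assms(2,3)] m point_QG_character
          closure_of_subset[of "point_QG ` cone p k k g m" X_QG]
        by (auto simp: topspace_X_QG)
      then have "cmod (point_QG (g m) f - \<xi> f) \<le> e/2"
        by (rule closure_eval_small[OF _ \<xi> f]) (use m in auto)
      then show "dist (f (g m)) (\<xi> f) < e"
        using f \<open>e > 0\<close> by (simp add: dist_norm point_QG_apply)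
    qed
  qed
  then have "limitin (product_topology (\<lambda>_. euclidean) C_QG) (\<lambda>n. point_QG (g n)) \<xi> sequentially"
    using char point_QG_character
    unfolding limitin_componentwise by (auto simp: characters_def point_QG_def PiE_def)
  then show ?thesis
    using char point_QG_character
    unfolding X_QG_def maximal_ideal_space_def limitin_subtopology
    by (simp add: always_eventually point_QG_character)
qed

text \<open>
  The cones are fine enough to separate boundary points: a function that tells two of them apart
  also tells apart the cones over long enough initial segments of their rays.
\<close>
lemma disjoint_cone_closures:
  assumes "k \<ge> 1"
    and g: "integral_quasi_geodesic_ray k k g" "originates_at {1..} g p"
      "\<And>m. 1 \<le> m \<Longrightarrow> \<xi> \<in> X_QG closure_of (point_QG ` cone p k k g m)"
    and h: "integral_quasi_geodesic_ray k k h" "originates_at {1..} h p"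
      "\<And>m. 1 \<le> m \<Longrightarrow> \<eta> \<in> X_QG closure_of (point_QG ` cone p k k h m)"
    and "\<xi> \<noteq> \<eta>"
  shows "\<exists>m\<ge>1. disjnt (X_QG closure_of (point_QG ` cone p k k g m))
                       (X_QG closure_of (point_QG ` cone p k k h m))"
proof -
  have "\<xi> \<in> extensional C_QG" "\<eta> \<in> extensional C_QG"
    using g(3)[of 1] h(3)[of 1] in_closure_of[of _ X_QG]
    by (auto simp: topspace_X_QG characters_def)
  then obtain f where f: "f \<in> C_QG" "\<xi> f \<noteq> \<eta> f"
    using \<open>\<xi> \<noteq> \<eta>\<close> extensionalityI by metis
  \<comment> \<open>A common point \<open>\<zeta>\<close> of the closures would give \<open>\<bar>\<xi> f - \<eta> f\<bar> \<le> 2 * \<epsilon>\<close>.\<close>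
  define \<epsilon> where "\<epsilon> = cmod (\<xi> f - \<eta> f) / 3"
  have \<epsilon>: "\<epsilon> > 0" "cmod (\<xi> f - \<eta> f) = 3 * \<epsilon>"
    using f by (simp_all add: \<epsilon>_def)
  have "\<forall>\<^sub>F m in sequentially. 1 \<le> m \<and>
      (\<forall>x\<in>cone p k k g m. \<forall>y\<in>cone p k k g m. cmod (f x - f y) < \<epsilon>) \<and>
      (\<forall>x\<in>cone p k k h m. \<forall>y\<in>cone p k k h m. cmod (f x - f y) < \<epsilon>)"
    using C_QG_eventually_small_on_cone f(1) assms(1) g(1,2) h(1,2) \<epsilon>(1)
    by (intro eventually_conj eventually_ge_at_top) blast+
  from eventually_happens'[OF sequentially_bot this] obtain m where m: "1 \<le> m"
      "\<forall>x\<in>cone p k k g m. \<forall>y\<in>cone p k k g m. cmod (f x - f y) < \<epsilon>"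
      "\<forall>x\<in>cone p k k h m. \<forall>y\<in>cone p k k h m. cmod (f x - f y) < \<epsilon>"
    by blast
  have False if "\<zeta> \<in> X_QG closure_of (point_QG ` cone p k k g m)"
    "\<zeta> \<in> X_QG closure_of (point_QG ` cone p k k h m)" for \<zeta>
  proof -
    have "cmod (\<xi> f - \<zeta> f) \<le> \<epsilon>"
      by (rule closure_eval_small[OF g(3)[OF m(1)] that(1) f(1)]) (use m in auto)
    moreover have "cmod (\<zeta> f - \<eta> f) \<le> \<epsilon>"
      by (rule closure_eval_small[OF that(2) h(3)[OF m(1)] f(1)]) (use m in auto)
    moreover have "cmod (\<xi> f - \<eta> f) \<le> cmod (\<xi> f - \<zeta> f) + cmod (\<zeta> f - \<eta> f)"
      using norm_triangle_ineq[of "\<xi> f - \<zeta> f" "\<zeta> f - \<eta> f"] by simp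
    ultimately show False
      using \<epsilon> by linarith
  qed
  then show ?thesis
    using m(1) by (auto simp: disjnt_iff)
qed

theorem proposition4p4:
  fixes x0 :: "'a::metric_space" and k :: real
  assumes "k \<ge> 1"
    and "discrete (UNIV :: 'a set)"
    and "proper_space TYPE('a)"
    and "integrally_quasi_geodesic_space TYPE('a) k k"
  shows "compact_space (subtopology X_QG (boundary_QG :: (('a \<Rightarrow> complex) \<Rightarrow> complex) set))
    \<and> metrizable_space (subtopology X_QG (boundary_QG :: (('a \<Rightarrow> complex) \<Rightarrow> complex) set))
    \<and> (\<forall>\<xi> \<in> (boundary_QG :: (('a \<Rightarrow> complex) \<Rightarrow> complex) set).
         \<exists>g. integral_quasi_geodesic_ray k k g \<and> originates_at {1..} g x0 \<and>
             limitin X_QG (\<lambda>n. point_QG (g n)) \<xi> sequentially)"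
proof -
  let ?bd = "boundary_QG :: (('a \<Rightarrow> complex) \<Rightarrow> complex) set"
  let ?Y = "subtopology X_QG ?bd"
  have fin: "finite (cball p r)" for p :: 'a and r
    using assms(2,3) discrete_subset[of UNIV "cball p r"] discrete_compact_finite_iff
    by (auto simp: proper_space_def)
  have "(UNIV :: 'a set) = (\<Union>n::nat. cball x0 (real n))"
    using real_arch_simple by fastforce
  then have "countable (UNIV :: 'a set)"
    by (metis countable_UN countableI_type countable_finite fin)
  note ray = exists_ray_with_boundary_point_in_cone_closures[OF assms(4) fin, of _ x0]
  have topspace_Y: "topspace ?Y = ?bd"
    by (auto simp: boundary_QG_def)
  have compact: "compact_space ?Y"
    using closedin_compact_space[OF compact_space_X_QG closedin_boundary_QG[OF assms(2)]]
    by (rule compact_space_subtopology)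
  define cl where "cl C = ?bd \<inter> X_QG closure_of (point_QG ` C)" for C :: "'a set"
  define \<K> where "\<K> = cl ` {cone x0 k k g m | g m. True}"
  have "metrizable_space ?Y"
  proof (rule metrizable_space_if_countable_closed_separation[of _ \<K>])
    show "compact_space ?Y" by fact
    show "Hausdorff_space ?Y"
      by (rule Hausdorff_space_subtopology[OF Hausdorff_space_X_QG])
    show "countable \<K>"
      unfolding \<K>_def by (intro countable_image countable_cones) fact
    show "closedin ?Y K" if "K \<in> \<K>" for K
      using that unfolding \<K>_def cl_def by (auto intro: closedin_subtopology_Int_closed)
    fix \<xi> \<eta> assume "\<xi> \<in> topspace ?Y" "\<eta> \<in> topspace ?Y" "\<xi> \<noteq> \<eta>"
    then have bd: "\<xi> \<in> ?bd" "\<eta> \<in> ?bd"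
      by (simp_all only: topspace_Y)
    obtain g where g: "integral_quasi_geodesic_ray k k g" "originates_at {1..} g x0"
      "\<And>m. 1 \<le> m \<Longrightarrow> \<xi> \<in> X_QG closure_of (point_QG ` cone x0 k k g m)"
      using ray[OF bd(1)] by blast
    obtain h where h: "integral_quasi_geodesic_ray k k h" "originates_at {1..} h x0"
      "\<And>m. 1 \<le> m \<Longrightarrow> \<eta> \<in> X_QG closure_of (point_QG ` cone x0 k k h m)"
      using ray[OF bd(2)] by blast
    obtain m where m: "1 \<le> m" "disjnt (X_QG closure_of (point_QG ` cone x0 k k g m))
                       (X_QG closure_of (point_QG ` cone x0 k k h m))"
      using disjoint_cone_closures[OF assms(1) g h \<open>\<xi> \<noteq> \<eta>\<close>] by blast
    show "\<exists>K\<in>\<K>. \<exists>L\<in>\<K>. \<xi> \<in> K \<and> \<eta> \<in> L \<and> disjnt K L"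
    proof (intro bexI conjI)
      show "\<xi> \<in> cl (cone x0 k k g m)" "\<eta> \<in> cl (cone x0 k k h m)"
        using bd g(3) h(3) m(1) by (auto simp: cl_def)
      show "disjnt (cl (cone x0 k k g m)) (cl (cone x0 k k h m))"
        using m(2) by (auto simp: cl_def disjnt_iff)
    qed (auto simp: \<K>_def)
  qed
  moreover have "\<exists>g. integral_quasi_geodesic_ray k k g \<and> originates_at {1..} g x0 \<and>
      limitin X_QG (\<lambda>n. point_QG (g n)) \<xi> sequentially" if \<xi>: "\<xi> \<in> ?bd" for \<xi>
  proof -
    obtain g where "integral_quasi_geodesic_ray k k g" "originates_at {1..} g x0"
      "\<And>m. 1 \<le> m \<Longrightarrow> \<xi> \<in> X_QG closure_of (point_QG ` cone x0 k k g m)"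
      using ray[OF \<xi>] by blast
    then show ?thesis
      using limitin_X_QG_if_in_cone_closures[OF assms(1)] by blast
  qed
  ultimately show ?thesis
    using compact by blast
qed

end
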